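(* Let $k$ be a positive integer and $n \geq 2k+3$. Then, for each choice of sign $\pm$ and each $\ast \in \{>,<\}$, $$1^k R_{n,1}^{D,\ast,\pm} + 3^k R_{n,3}^{D,\ast,\pm} + 5^k R_{n,5}^{D,\ast,\pm} + \cdots = 2^k R_{n,2}^{D,\ast,\pm} + 4^k R_{n,4}^{D,\ast,\pm} + 6^k R_{n,6}^{D,\ast,\pm} + \cdots,$$ $$1^k R_{n,1}^{B-D,\ast,\pm} + 3^k R_{n,3}^{B-D,\ast,\pm} + \cdots = 2^k R_{n,2}^{B-D,\ast,\pm} + 4^k R_{n,4}^{B-D,\ast,\pm} + \cdots.$$
   Context: $\mathfrak{B}_n$ is the set of signed permutations of $[n]$, written as words $\pi = \pi_1,\ldots,\pi_n$ with $\pi_i \in \{\pm 1,\ldots,\pm n\}$ and $|\pi_1|,\ldots,|\pi_n|$ a permutation of $[n]$. $\mathfrak{D}_n \subseteq \mathfrak{B}_n$ consists of those $\pi$ with an even number of negative entries. Set $\pi_0 = 0$. For $1 \leq i \leq n-1$, $\pi$ changes direction at $i$ if $\pi_{i-1} < \pi_i > \pi_{i+1}$ or $\pi_{i-1} > \pi_i < \pi_{i+1}$; $\mathrm{altruns}_D(\pi) = \mathrm{altruns}_B(\pi)$ is $1$ plus the number of such indices. Let $\mathsf{inv}_D(\pi) = |\{1 \le i<j \le n : \pi_i > \pi_j\}| + |\{1 \le i<j \le n : -\pi_i > \pi_j\}|$. For $X \in \{\mathfrak{D}_n, \mathfrak{B}_n - \mathfrak{D}_n\}$ let $X^> = \{\pi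 \in X : \pi_1 > 0\}$, $X^< = \{\pi \in X : \pi_1 < 0\}$, and for $\ast \in \{>,<\}$ let $X^{\ast,+}$ (resp. $X^{\ast,-}$) be the set of $\pi \in X^\ast$ with $\mathsf{inv}_D(\pi)$ even (resp. odd). $R_{n,i}^{D,\ast,\pm}$ (resp. $R_{n,i}^{B-D,\ast,\pm}$) is the number of $\pi \in \mathfrak{D}_n^{\ast,\pm}$ (resp. $(\mathfrak{B}_n-\mathfrak{D}_n)^{\ast,\pm}$) with $\mathrm{altruns}_D(\pi) = i$. *)

theory Defs
  imports Main
begin

text \<open>
  A signed permutation of \<open>{1..n}\<close> is represented by its word \<open>[\<pi>\<^sub>1, \<dots>, \<pi>\<^sub>n]\<close>.
  Prepending \<open>0\<close> makes \<open>entry w i\<close> the value \<open>\<pi>\<^sub>i\<close> for \<open>0 \<le> i \<le> n\<close>,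
  including the convention \<open>\<pi>\<^sub>0 = 0\<close>.
\<close>

definition entry :: "int list \<Rightarrow> nat \<Rightarrow> int" where
  "entry w i = (0 # w) ! i"

definition signed_perms :: "nat \<Rightarrow> int list set" where
  "signed_perms n =
     {w. length w = n \<and> bij_betw (\<lambda>i. \<bar>entry w i\<bar>) {1..n} {1..int n}}"

definition even_signed_perms :: "nat \<Rightarrow> int list set" where
  "even_signed_perms n =
     {w \<in> signed_perms n. even (card {i \<in> {1..n}. entry w i < 0})}"

definition changes_direction :: "int list \<Rightarrow> nat \<Rightarrow> bool" where
  "changes_direction w i \<longleftrightarrow>
     (entry w (i - 1) < entry w i \<and> entry w i > entry w (i + 1)) \<or>
     (entry w (i - 1) > entry w i \<and> entry w i < entry w (i + 1))"

definition altruns :: "int list \<Rightarrow> nat" where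
  "altruns w = 1 + card {i. 1 \<le> i \<and> i + 1 \<le> length w \<and> changes_direction w i}"

definition inv_D :: "int list \<Rightarrow> nat" where
  "inv_D w =
     card {(i, j). 1 \<le> i \<and> i < j \<and> j \<le> length w \<and> entry w i > entry w j} +
     card {(i, j). 1 \<le> i \<and> i < j \<and> j \<le> length w \<and> - entry w i > entry w j}"

datatype first_sign = First_Pos | First_Neg

datatype parity_sign = Plus | Minus

fun restrict_first :: "first_sign \<Rightarrow> int list set \<Rightarrow> int list set" where
  "restrict_first First_Pos X = {w \<in> X. entry w 1 > 0}"
| "restrict_first First_Neg X = {w \<in> X. entry w 1 < 0}"

fun restrict_inv :: "parity_sign \<Rightarrow> int list set \<Rightarrow> int list set" where
  "restrict_inv Plus X = {w \<in> X. even (inv_D w)}"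
| "restrict_inv Minus X = {w \<in> X. odd (inv_D w)}"

definition R_D :: "first_sign \<Rightarrow> parity_sign \<Rightarrow> nat \<Rightarrow> nat \<Rightarrow> nat" where
  "R_D f s n i =
     card {w \<in> restrict_inv s (restrict_first f (even_signed_perms n)). altruns w = i}"

definition R_BD :: "first_sign \<Rightarrow> parity_sign \<Rightarrow> nat \<Rightarrow> nat \<Rightarrow> nat" where
  "R_BD f s n i =
     card {w \<in> restrict_inv s (restrict_first f (signed_perms n - even_signed_perms n)).
             altruns w = i}"

text \<open>
  The sets being counted are finite, and the counts vanish beyond \<open>i = n\<close>, so that sums over
  all \<open>i \<ge> 1\<close> may be cut off at \<open>n\<close>.
\<close>

lemma finite_signed_perms: "finite (signed_perms n)"
proof (rule finite_subset)
  show "signed_perms n \<subseteq> {w. set w \<subseteq> {- int n..int n} \<and> length w = n}"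
  proof (clarsimp simp: signed_perms_def)
    fix w x
    assume bij: "bij_betw (\<lambda>i. \<bar>entry w i\<bar>) {Suc 0..length w} {1..int (length w)}"
      and "x \<in> set w"
    then obtain j where "j < length w" "x = w ! j"
      by (auto simp: in_set_conv_nth)
    then have "\<bar>x\<bar> \<in> (\<lambda>i. \<bar>entry w i\<bar>) ` {Suc 0..length w}"
      by (intro image_eqI[of _ _ "Suc j"]) (auto simp: entry_def)
    with bij have "\<bar>x\<bar> \<in> {1..int (length w)}"
      by (simp add: bij_betw_def)
    then show "- int (length w) \<le> x \<and> x \<le> int (length w)"
      by auto
  qed
  show "finite {w. set w \<subseteq> {- int n..int n} \<and> length w = n}"
    by (rule finite_lists_length_eq) simp
qed

lemma altruns_le_length:
  assumes "w \<noteq> []"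
  shows "altruns w \<le> length w"
proof -
  have "card {i. 1 \<le> i \<and> i + 1 \<le> length w \<and> changes_direction w i} \<le> card {1..<length w}"
    by (rule card_mono) auto
  with assms show ?thesis
    by (cases w) (auto simp: altruns_def)
qed

lemma R_eq_0:
  assumes "0 < n" "n < i"
  shows "R_D f s n i = 0" "R_BD f s n i = 0"
proof -
  have *: "altruns w \<noteq> i" if "w \<in> signed_perms n" for w
    using that assms altruns_le_length[of w] by (auto simp: signed_perms_def)
  have **: "{w \<in> restrict_inv s (restrict_first f X). altruns w = i} = {}"
    if "X \<subseteq> signed_perms n" for X
    using that * by (cases s; cases f) auto
  have "even_signed_perms n \<subseteq> signed_perms n"
    by (auto simp: even_signed_perms_def)
  then show "R_D f s n i = 0"
    by (simp only: R_D_def ** card.empty)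
  show "R_BD f s n i = 0"
    by (simp only: R_BD_def **[OF Diff_subset] card.empty)
qed

end

theory Submission
  imports Defs
begin

text \<open>
  Negating a suffix of even length that starts at a position \<open>i\<close> with \<open>2 \<le> i \<le> n - 1\<close> keeps
  \<open>\<pi>\<^sub>1\<close>, the parity of the number of negative entries and the parity of \<open>inv_D\<close>: the latter is the
  parity of the number of inversions of \<open>\<bar>\<pi>\<bar>\<close>. It changes the parity of \<open>altruns\<close>, since this
  parity depends only on the directions of the first and of the last step. A change of direction
  at \<open>p\<close> is affected only if \<open>i \<in> {p, p + 1}\<close>, so it is sensitive to at most one of the \<open>k + 1\<close>
  negations starting at \<open>n - 1, n - 3, \<dots>, n - 1 - 2 k\<close>. Expanding the \<open>k\<close>-th power of
  \<open>altruns\<close> into products of indicators of changes of direction, each product is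
  invariant under one of these negations, which therefore cancels its contribution to
  \<open>\<Sum>\<pi>. (- 1) ^ altruns \<pi> * altruns \<pi> ^ k\<close>.
\<close>

section \<open>Cancellation of alternating power sums by involutions\<close>

lemma sum_eq_0_if_involution_negates:
  fixes F :: "'w \<Rightarrow> int"
  assumes closed: "\<And>w. w \<in> W \<Longrightarrow> c w \<in> W"
    and inv: "\<And>w. w \<in> W \<Longrightarrow> c (c w) = w"
    and neg: "\<And>w. w \<in> W \<Longrightarrow> F (c w) = - F w"
  shows "(\<Sum>w\<in>W. F w) = 0"
proof -
  have "(\<Sum>w\<in>W. F w) = (\<Sum>w\<in>W. F (c w))"
    by (rule sum.reindex_bij_witness[where i = c and j = c]) (auto simp: closed inv)
  also have "\<dots> = - (\<Sum>w\<in>W. F w)"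
    by (simp add: neg sum_negf)
  finally show ?thesis by simp
qed

text \<open>The induction peels one factor \<open>h p\<close> off the power and absorbs it into the
  weight \<open>g\<close>; \<open>J\<close> holds the indices whose involutions still preserve
  \<open>g\<close>. Each peeled factor spoils at most one index, so \<open>k < card J\<close> leaves
  an involution when the power is used up.\<close>

lemma alternating_power_sum_eq_0:
  fixes c :: "'i \<Rightarrow> 'w \<Rightarrow> 'w" and h :: "'p \<Rightarrow> 'w \<Rightarrow> int" and s g :: "'w \<Rightarrow> int"
  assumes closed: "\<And>i w. i \<in> I \<Longrightarrow> w \<in> W \<Longrightarrow> c i w \<in> W"
    and inv: "\<And>i w. i \<in> I \<Longrightarrow> w \<in> W \<Longrightarrow> c i (c i w) = w"
    and neg: "\<And>i w. i \<in> I \<Longrightarrow> w \<in> W \<Longrightarrow> s (c i w) = - s w"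
    and h: "\<And>p. p \<in> P \<Longrightarrow> \<exists>i\<^sub>0. \<forall>i\<in>I - {i\<^sub>0}. \<forall>w\<in>W. h p (c i w) = h p w"
    and "finite J" "J \<subseteq> I" "k < card J"
    and "\<And>i w. i \<in> J \<Longrightarrow> w \<in> W \<Longrightarrow> g (c i w) = g w"
  shows "(\<Sum>w\<in>W. s w * g w * (\<Sum>p\<in>P. h p w) ^ k) = 0"
  using assms(5-8)
proof (induction k arbitrary: J g)
  case 0
  then obtain i where "i \<in> J" by fastforce
  with 0 show ?case
    by (intro sum_eq_0_if_involution_negates[where c = "c i"])
       (auto simp: closed inv neg subset_iff)
next
  case (Suc k)
  have "(\<Sum>w\<in>W. s w * (h p w * g w) * (\<Sum>p\<in>P. h p w) ^ k) = 0" if "p \<in> P" for p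
  proof -
    obtain i\<^sub>0 where i\<^sub>0: "\<forall>i\<in>I - {i\<^sub>0}. \<forall>w\<in>W. h p (c i w) = h p w"
      using h[OF \<open>p \<in> P\<close>] by blast
    show ?thesis
    proof (rule Suc.IH[of "J - {i\<^sub>0}"])
      show "k < card (J - {i\<^sub>0})"
        using Suc.prems(1,3) by (cases "i\<^sub>0 \<in> J") auto
      show "h p (c i w) * g (c i w) = h p w * g w" if "i \<in> J - {i\<^sub>0}" "w \<in> W" for i w
        using that i\<^sub>0 Suc.prems(2,4) by auto
    qed (use Suc.prems in auto)
  qed
  then have "(\<Sum>p\<in>P. \<Sum>w\<in>W. s w * (h p w * g w) * (\<Sum>p\<in>P. h p w) ^ k) = 0"
    by simp
  \<comment> \<open>Exchanging the two sums turns the sum over \<open>p\<close> back into the peeled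
    factor.\<close>
  then show ?case
    by (subst (asm) sum.swap) (simp add: sum_distrib_left sum_distrib_right mult_ac)
qed

section \<open>Negation of a suffix: membership and the parity of \<open>inv_D\<close>\<close>

text \<open>Positions are 1-based as in \<open>entry\<close>: the first negated letter is the one at
  position \<open>i\<close>.\<close>

definition negate_from :: "nat \<Rightarrow> int list \<Rightarrow> int list" where
  "negate_from i w = take (i - 1) w @ map uminus (drop (i - 1) w)"

lemma length_negate_from [simp]: "length (negate_from i w) = length w"
  by (simp add: negate_from_def)

lemma entry_negate_from:
  assumes "0 < i" "j \<le> length w"
  shows "entry (negate_from i w) j = (if j < i then entry w j else - entry w j)"
  using assms by (cases j) (auto simp: entry_def negate_from_def nth_append)

lemma negate_from_negate_from [simp]: "negate_from i (negate_from i w) = w"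
  by (cases "i - 1 \<le> length w") (auto simp: negate_from_def o_def)

lemma signed_perms_length: "w \<in> signed_perms n \<Longrightarrow> length w = n"
  by (simp add: signed_perms_def)

text \<open>Index 0 is included, since \<open>entry w 0 = 0\<close> while all other entries have
  absolute value at least 1. Hence letters are nonzero and no step is level, not even the first one
  from 0.\<close>

lemma signed_perms_abs_entry_neq:
  assumes "w \<in> signed_perms n" "i \<le> n" "j \<le> n" "i \<noteq> j"
  shows "\<bar>entry w i\<bar> \<noteq> \<bar>entry w j\<bar>"
proof -
  have bij: "bij_betw (\<lambda>i. \<bar>entry w i\<bar>) {1..n} {1..int n}"
    using assms(1) by (simp add: signed_perms_def)
  have pos: "\<bar>entry w l\<bar> \<ge> 1" if "l \<in> {1..n}" for l
    using bij_betwE[OF bij] that by auto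
  have 0: "entry w 0 = 0" by (simp add: entry_def)
  show ?thesis
  proof (cases "i = 0 \<or> j = 0")
    case True
    with assms pos[of i] pos[of j] 0 show ?thesis by fastforce
  next
    case False
    with assms show ?thesis
      using inj_onD[OF bij_betw_imp_inj_on[OF bij], of i j] by auto
  qed
qed

lemma negate_from_signed_perms:
  assumes "w \<in> signed_perms n" "0 < i"
  shows "negate_from i w \<in> signed_perms n"
proof -
  have len: "length w = n" using assms(1) by (rule signed_perms_length)
  have "bij_betw (\<lambda>j. \<bar>entry (negate_from i w) j\<bar>) {1..n} {1..int n} \<longleftrightarrow>
      bij_betw (\<lambda>j. \<bar>entry w j\<bar>) {1..n} {1..int n}"
    by (rule bij_betw_cong) (simp add: entry_negate_from len assms(2))
  with assms(1) show ?thesis by (simp add: signed_perms_def)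
qed

text \<open>The suffix has \<open>n - i + 1\<close> letters, an even number. Negation swaps its
  negative letters (\<open>B\<close>) with its positive ones (\<open>C\<close>), and two numbers
  with an even sum have the same parity.\<close>

lemma negate_from_even_signed_perms_iff:
  assumes "w \<in> signed_perms n" "0 < i" "i \<le> n" "odd (n - i)"
  shows "negate_from i w \<in> even_signed_perms n \<longleftrightarrow> w \<in> even_signed_perms n"
proof -
  let ?w = "negate_from i w"
  have len: "length w = n" using assms(1) by (rule signed_perms_length)
  define A where "A = {j \<in> {1..<i}. entry w j < 0}"
  define B where "B = {j \<in> {i..n}. entry w j < 0}"
  define C where "C = {j \<in> {i..n}. entry w j > 0}"
  have fin: "finite A" "finite B" "finite C" by (auto simp: A_def B_def C_def)
  have "{j \<in> {1..n}. entry w j < 0} = A \<union> B"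
    using assms(2,3) by (auto simp: A_def B_def)
  then have 1: "card {j \<in> {1..n}. entry w j < 0} = card A + card B"
    using fin by (auto simp: A_def B_def intro!: card_Un_disjoint)
  have "{j \<in> {1..n}. entry ?w j < 0} = A \<union> C"
    using assms(2,3) by (auto simp: A_def C_def entry_negate_from len split: if_splits)
  then have 2: "card {j \<in> {1..n}. entry ?w j < 0} = card A + card C"
    using fin by (auto simp: A_def C_def intro!: card_Un_disjoint)
  have nz: "entry w j \<noteq> 0" if "j \<in> {i..n}" for j
    using signed_perms_abs_entry_neq[OF assms(1), of 0 j] that assms(2) by (auto simp: entry_def)
  have "B \<union> C = {i..n}"
    using nz by (force simp: B_def C_def)
  moreover have "card (B \<union> C) = card B + card C"
    using fin by (intro card_Un_disjoint) (auto simp: B_def C_def)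
  ultimately have "card B + card C = Suc (n - i)"
    using assms(3) by simp
  then have "even (card B) = even (card C)"
    using assms(4) by (metis even_Suc even_add)
  with 1 2 negate_from_signed_perms[OF assms(1,2)] assms(1) show ?thesis
    by (simp add: even_signed_perms_def)
qed

text \<open>Pairs counted by both summands of \<open>inv_D\<close> do not affect the parity. For
  distinct absolute values, both conditions hold if the later entry is below
  \<open>-\<bar>entry w i\<bar>\<close>, neither if it is above
  \<open>\<bar>entry w i\<bar>\<close>, and exactly one in between.\<close>

lemma even_inv_D_iff:
  assumes "w \<in> signed_perms n"
  shows "even (inv_D w) \<longleftrightarrow>
    even (card {(i, j). 1 \<le> i \<and> i < j \<and> j \<le> n \<and> \<bar>entry w i\<bar> > \<bar>entry w j\<bar>})"
proof -
  have len: "length w = n" using assms by (rule signed_perms_length)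
  define A where "A = {(i, j). 1 \<le> i \<and> i < j \<and> j \<le> n \<and> entry w i > entry w j}"
  define B where "B = {(i, j). 1 \<le> i \<and> i < j \<and> j \<le> n \<and> - entry w i > entry w j}"
  have "A \<subseteq> {1..n} \<times> {1..n}" "B \<subseteq> {1..n} \<times> {1..n}"
    by (auto simp: A_def B_def)
  then have fin: "finite A" "finite B"
    by (auto intro: finite_subset)
  have neq: "\<bar>entry w i\<bar> \<noteq> \<bar>entry w j\<bar>" if "i < j" "j \<le> n" for i j
    using signed_perms_abs_entry_neq[OF assms, of i j] that by simp
  have "card A = card (A \<inter> B) + card (A - B)" "card B = card (A \<inter> B) + card (B - A)"
    using fin by (metis card_Diff_subset_Int card_Int_Diff Int_commute)+
  then have "even (card A + card B) \<longleftrightarrow> even (card (A - B) + card (B - A))"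
    by presburger
  also have "card (A - B) + card (B - A) = card ((A - B) \<union> (B - A))"
    using fin by (intro card_Un_disjoint[symmetric]) auto
  also have "(A - B) \<union> (B - A) =
      {(i, j). 1 \<le> i \<and> i < j \<and> j \<le> n \<and> \<bar>entry w i\<bar> > \<bar>entry w j\<bar>}"
    using neq by (fastforce simp: A_def B_def)
  finally show ?thesis
    by (simp add: inv_D_def A_def B_def len)
qed

lemma even_inv_D_negate_from:
  assumes "w \<in> signed_perms n" "0 < i"
  shows "even (inv_D (negate_from i w)) \<longleftrightarrow> even (inv_D w)"
proof -
  have len: "length w = n" using assms(1) by (rule signed_perms_length)
  have "\<bar>entry (negate_from i w) j\<bar> = \<bar>entry w j\<bar>" if "j \<le> n" for j
    using that assms(2) by (simp add: entry_negate_from len)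
  then have "{(a, b). 1 \<le> a \<and> a < b \<and> b \<le> n \<and>
        \<bar>entry (negate_from i w) a\<bar> > \<bar>entry (negate_from i w) b\<bar>} =
      {(a, b). 1 \<le> a \<and> a < b \<and> b \<le> n \<and> \<bar>entry w a\<bar> > \<bar>entry w b\<bar>}"
    by auto
  then show ?thesis
    using even_inv_D_iff[OF assms(1)] even_inv_D_iff[OF negate_from_signed_perms[OF assms]]
    by simp
qed

section \<open>Alternating runs and the directions of steps\<close>

text \<open>The term at \<open>p = 0\<close> supplies the leading 1 of \<open>altruns\<close>,
  giving a plain sum of indicators whose power can be expanded.\<close>

lemma altruns_eq_sum:
  assumes "length w = Suc m"
  shows "int (altruns w) = (\<Sum>p\<le>m. of_bool (p = 0 \<or> changes_direction w p))"
proof -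
  have "{p. 1 \<le> p \<and> p + 1 \<le> length w \<and> changes_direction w p} =
      {p \<in> {1..m}. changes_direction w p}"
    using assms by auto
  moreover have "{..m} = insert 0 {1..m}" by auto
  ultimately show ?thesis
    by (simp add: altruns_def Int_def)
qed

text \<open>Only the entries at \<open>p - 1\<close>, \<open>p\<close> and \<open>p + 1\<close>
  matter. The excluded values of \<open>i\<close> are those separating them; otherwise all three
  keep their signs, or all are negated and peaks and valleys swap.\<close>

lemma changes_direction_negate_from:
  assumes "0 < i" "p < length w" "i \<noteq> p" "i \<noteq> Suc p"
  shows "changes_direction (negate_from i w) p \<longleftrightarrow> changes_direction w p"
  using assms by (auto simp: changes_direction_def entry_negate_from)

lemma minus_one_power_changes:
  assumes w: "w \<in> signed_perms n" and "m < n"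
  shows "(- 1 :: int) ^ card {p \<in> {1..m}. changes_direction w p} =
    sgn (entry w 1 - entry w 0) * sgn (entry w (Suc m) - entry w m)"
  using \<open>m < n\<close>
proof (induction m)
  case 0
  have "entry w 1 \<noteq> entry w 0"
    using signed_perms_abs_entry_neq[OF w, of 1 0] 0 by auto
  then show ?case by (simp add: sgn_if)
next
  case (Suc m)
  have neq: "entry w (Suc m) \<noteq> entry w m" "entry w (Suc (Suc m)) \<noteq> entry w (Suc m)"
    using signed_perms_abs_entry_neq[OF w, of "Suc m" m]
      signed_perms_abs_entry_neq[OF w, of "Suc (Suc m)" "Suc m"] Suc.prems by auto
  have "{p \<in> {1..Suc m}. changes_direction w p} =
      (if changes_direction w (Suc m) then insert (Suc m) else id)
        {p \<in> {1..m}. changes_direction w p}"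
    by (auto simp: le_Suc_eq)
  then have "(- 1 :: int) ^ card {p \<in> {1..Suc m}. changes_direction w p} =
      (- 1) ^ card {p \<in> {1..m}. changes_direction w p} *
      (if changes_direction w (Suc m) then - 1 else 1)"
    by simp
  also have "\<dots> = sgn (entry w 1 - entry w 0) * (sgn (entry w (Suc m) - entry w m) *
      (if changes_direction w (Suc m) then - 1 else 1))"
    using Suc by simp
  \<comment> \<open>As neither step is level, a change of direction means exactly that the two
    adjacent steps have opposite signs.\<close>
  also have "sgn (entry w (Suc m) - entry w m) *
      (if changes_direction w (Suc m) then - 1 else 1) =
      sgn (entry w (Suc (Suc m)) - entry w (Suc m))"
    using neq by (auto simp: changes_direction_def sgn_if)
  finally show ?case .
qed

lemma minus_one_power_altruns:
  assumes w: "w \<in> signed_perms n" and "0 < n"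
  shows "(- 1 :: int) ^ altruns w =
    - (sgn (entry w 1 - entry w 0) * sgn (entry w n - entry w (n - 1)))"
proof -
  have "{p. 1 \<le> p \<and> p + 1 \<le> length w \<and> changes_direction w p} =
      {p \<in> {1..n - 1}. changes_direction w p}"
    using signed_perms_length[OF w] by auto
  then show ?thesis
    using minus_one_power_changes[OF w, of "n - 1"] \<open>0 < n\<close> by (simp add: altruns_def)
qed

text \<open>\<open>2 \<le> i\<close> leaves the first step alone, while \<open>i < n\<close> puts
  both ends of the last step into the negated suffix and reverses it.\<close>

lemma minus_one_power_altruns_negate_from:
  assumes "w \<in> signed_perms n" "2 \<le> i" "i < n"
  shows "(- 1 :: int) ^ altruns (negate_from i w) = - ((- 1) ^ altruns w)"
  using assms negate_from_signed_perms[OF assms(1), of i] signed_perms_length[OF assms(1)]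
  by (auto simp: minus_one_power_altruns entry_negate_from sgn_if)

section \<open>The alternating sum and its split into odd and even run counts\<close>

lemma alternating_altruns_sum_eq_0:
  assumes W: "W \<subseteq> signed_perms n" and n: "n \<ge> 2 * k + 3"
    and closed: "\<And>i w. 2 \<le> i \<Longrightarrow> i < n \<Longrightarrow> odd (n - i) \<Longrightarrow> w \<in> W \<Longrightarrow> negate_from i w \<in> W"
  shows "(\<Sum>w\<in>W. (- 1) ^ altruns w * int (altruns w) ^ k) = 0"
proof -
  define m where "m = n - 1"
  \<comment> \<open>The smallest start is \<open>n - 1 - 2 * k\<close>, which is at least 2 exactly
    by the bound on \<open>n\<close>. Spacing 2 keeps every suffix length even and keeps consecutive
    positions from both lying in \<open>I\<close>.\<close>
  define I where "I = (\<lambda>j. n - 1 - 2 * j) ` {..k}"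
  define h where "h p w = (of_bool (p = 0 \<or> changes_direction w p) :: int)" for p w
  have inj: "inj_on (\<lambda>j. n - 1 - 2 * j) {..k}"
    using n by (auto simp: inj_on_def)
  have I: "2 \<le> i" "i < n" "odd (n - i)" if "i \<in> I" for i
    using that n by (auto simp: I_def)
  have len: "length w = Suc m" if "w \<in> W" for w
    using that W n signed_perms_length by (auto simp: m_def)
  have sparse: "\<exists>i\<^sub>0. \<forall>i\<in>I - {i\<^sub>0}. \<forall>w\<in>W. h p (negate_from i w) = h p w" if "p \<in> {..m}" for p
  proof -
    \<comment> \<open>The exceptional index is \<open>p\<close> if \<open>p \<in> I\<close>, as then
      \<open>Suc p\<close> has the wrong parity, and \<open>Suc p\<close> otherwise.\<close>
    have "\<exists>i\<^sub>0. \<forall>i\<in>I - {i\<^sub>0}. i \<noteq> p \<and> i \<noteq> Suc p"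
    proof (cases "p \<in> I")
      case True
      then have "Suc p \<notin> I" using I[of p] I[of "Suc p"] by auto
      then show ?thesis by auto
    qed auto
    then obtain i\<^sub>0 where "\<forall>i\<in>I - {i\<^sub>0}. i \<noteq> p \<and> i \<noteq> Suc p" ..
    then have "\<forall>i\<in>I - {i\<^sub>0}. \<forall>w\<in>W. h p (negate_from i w) = h p w"
      using I(1) \<open>p \<in> {..m}\<close> len
      by (fastforce simp: h_def changes_direction_negate_from less_Suc_eq_le)
    then show ?thesis ..
  qed
  \<comment> \<open>The factor 1 is the initial weight \<open>g\<close>, preserved by all of
    \<open>I\<close>.\<close>
  have "(\<Sum>w\<in>W. (- 1) ^ altruns w * 1 * (\<Sum>p\<le>m. h p w) ^ k) = 0"
  proof (rule alternating_power_sum_eq_0[where c = negate_from and I = I and J = I])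
    show "negate_from i w \<in> W" if "i \<in> I" "w \<in> W" for i w
      using closed I that by blast
    show "(- 1) ^ altruns (negate_from i w) = - ((- 1) ^ altruns w :: int)"
      if "i \<in> I" "w \<in> W" for i w
      using minus_one_power_altruns_negate_from I that W by blast
    show "k < card I"
      unfolding I_def card_image[OF inj] by simp
  qed (use sparse in \<open>auto simp: I_def\<close>)
  then show ?thesis
    by (simp add: h_def altruns_eq_sum[OF len])
qed

lemma odd_even_altruns_sums_eq:
  assumes W: "W \<subseteq> signed_perms n" and n: "n \<ge> 2 * k + 3"
    and closed: "\<And>i w. 2 \<le> i \<Longrightarrow> i < n \<Longrightarrow> odd (n - i) \<Longrightarrow> w \<in> W \<Longrightarrow> negate_from i w \<in> W"
  shows "(\<Sum>i | i \<in> {1..n} \<and> odd i. i ^ k * card {w \<in> W. altruns w = i}) =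
         (\<Sum>i | i \<in> {1..n} \<and> even i. i ^ k * card {w \<in> W. altruns w = i})"
    (is "?odd = ?even")
proof -
  have fin: "finite W"
    using W finite_signed_perms finite_subset by blast
  have range: "altruns w \<in> {1..n}" if "w \<in> W" for w
  proof -
    have "length w = n" using W that signed_perms_length by blast
    with altruns_le_length[of w] n show ?thesis
      by (cases "w = []") (auto simp: altruns_def)
  qed
  have 0: "(\<Sum>i\<in>{1..n}. (- 1) ^ i * int (i ^ k * card {w \<in> W. altruns w = i})) = 0"
  proof -
    have "(\<Sum>i\<in>{1..n}. (- 1) ^ i * int (i ^ k * card {w \<in> W. altruns w = i})) =
        (\<Sum>i\<in>{1..n}. \<Sum>w | w \<in> W \<and> altruns w = i. (- 1) ^ altruns w * int (altruns w) ^ k)"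
      by (intro sum.cong) (simp_all add: mult_ac)
    \<comment> \<open>Grouping by the value of \<open>altruns\<close> loses no word, because all
      values lie in \<open>{1..n}\<close>.\<close>
    also have "\<dots> = (\<Sum>w\<in>W. (- 1) ^ altruns w * int (altruns w) ^ k)"
      using range by (intro sum.group fin) auto
    finally show ?thesis
      using alternating_altruns_sum_eq_0[OF assms] by simp
  qed
  have split: "{1..n} = {i. i \<in> {1..n} \<and> even i} \<union> {i. i \<in> {1..n} \<and> odd i}"
    by auto
  have "(\<Sum>i\<in>{1..n}. (- 1) ^ i * int (i ^ k * card {w \<in> W. altruns w = i})) =
      (\<Sum>i | i \<in> {1..n} \<and> even i. (- 1) ^ i * int (i ^ k * card {w \<in> W. altruns w = i})) +
      (\<Sum>i | i \<in> {1..n} \<and> odd i. (- 1) ^ i * int (i ^ k * card {w \<in> W. altruns w = i}))"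
    by (subst split, rule sum.union_disjoint) auto
  also have "\<dots> = int ?even - int ?odd"
    by (simp add: sum_negf)
  \<comment> \<open>Rewriting with \<open>0\<close> leaves an equation with 0 on its left-hand side,
    hence the \<open>sym\<close>.\<close>
  finally have "int ?even = int ?odd"
    unfolding 0 by (rule eq_iff_diff_eq_0[THEN iffD2, OF sym])
  then show ?thesis
    by (simp only: of_nat_eq_iff)
qed

text \<open>The first letter lies before the negated suffix, and the parity of \<open>inv_D\<close>
  depends only on absolute values.\<close>

lemma negate_from_restrict:
  assumes X: "X \<subseteq> signed_perms n"
    and closed: "\<And>w. w \<in> X \<Longrightarrow> negate_from i w \<in> X"
    and i: "2 \<le> i" "i < n"
    and w: "w \<in> restrict_inv s (restrict_first f X)"
  shows "negate_from i w \<in> restrict_inv s (restrict_first f X)"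
proof -
  have "w \<in> X" using w by (cases s; cases f) auto
  then have "w \<in> signed_perms n" using X by blast
  then show ?thesis
    using w closed[OF \<open>w \<in> X\<close>] i even_inv_D_negate_from[of w n i] signed_perms_length[of w n]
    by (cases s; cases f) (auto simp: entry_negate_from)
qed

lemma restrict_subset: "restrict_inv s (restrict_first f X) \<subseteq> X"
  by (cases s; cases f) auto

theorem theorem18:
  fixes k n :: nat and f :: first_sign and s :: parity_sign
  assumes "k > 0" and "n \<ge> 2 * k + 3"
  shows "((\<Sum>i | i \<in> {1..n} \<and> odd i. i ^ k * R_D f s n i) =
         (\<Sum>i | i \<in> {1..n} \<and> even i. i ^ k * R_D f s n i)) \<and>
         ((\<Sum>i | i \<in> {1..n} \<and> odd i. i ^ k * R_BD f s n i) =
         (\<Sum>i | i \<in> {1..n} \<and> even i. i ^ k * R_BD f s n i))"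
proof -
  have D: "even_signed_perms n \<subseteq> signed_perms n"
    by (auto simp: even_signed_perms_def)
  have *: "(\<Sum>i | i \<in> {1..n} \<and> odd i.
        i ^ k * card {w \<in> restrict_inv s (restrict_first f X). altruns w = i}) =
      (\<Sum>i | i \<in> {1..n} \<and> even i.
        i ^ k * card {w \<in> restrict_inv s (restrict_first f X). altruns w = i})"
    if X: "X = even_signed_perms n \<or> X = signed_perms n - even_signed_perms n" for X
  proof (rule odd_even_altruns_sums_eq[OF _ assms(2)])
    have sub: "X \<subseteq> signed_perms n" using X D by blast
    show "restrict_inv s (restrict_first f X) \<subseteq> signed_perms n"
      using restrict_subset sub by (rule subset_trans)
    fix i w
    assume i: "2 \<le> i" "i < n" "odd (n - i)" and w: "w \<in> restrict_inv s (restrict_first f X)"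
    \<comment> \<open>Because membership in \<open>even_signed_perms n\<close> is preserved in both
      directions, the same argument covers its complement.\<close>
    have "negate_from i v \<in> X" if "v \<in> X" for v
      using X that sub i negate_from_signed_perms[of v n i]
        negate_from_even_signed_perms_iff[of v n i] by auto
    then show "negate_from i w \<in> restrict_inv s (restrict_first f X)"
      using negate_from_restrict[OF sub] i w by blast
  qed
  show ?thesis
    unfolding R_D_def R_BD_def using * by blast
qed

end
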